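(* Let $R$ be a commutative ring with identity and $M$ an $R$-module. If $N$ is a weakly primary submodule of $M$ such that $(N:M)\subseteq J(R)$, then $N$ is a weakly $J$-submodule of $M$.
   Context: Rings are commutative with identity and modules are unital. $J(R)$ is the Jacobson radical of $R$. For a submodule $N$ of an $R$-module $M$, $(N:M)=\{r\in R: rM\subseteq N\}$. A proper submodule $N$ of $M$ is weakly primary if whenever $0\neq rm\in N$ for $r\in R$ and $m\in M$, then $r\in\sqrt{(N:M)}$ or $m\in N$. A proper submodule $N$ of $M$ is a weakly $J$-submodule if whenever $r\in R$, $m\in M$ satisfy $0\neq rm\in N$ and $r\notin (J(R)M:M)$, then $m\in N$. *)

theory Defs
  imports "HOL-Algebra.Module" "HOL-Algebra.Ideal"
begin

text \<open>Intersecting with the carrier only matters for the zero ring, which has no maximal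
  ideals.\<close>
definition jacobson_radical :: "('a, 'c) ring_scheme \<Rightarrow> 'a set" where
  "jacobson_radical R = carrier R \<inter> \<Inter>{I. maximalideal I R}"

definition ideal_radical :: "('a, 'c) ring_scheme \<Rightarrow> 'a set \<Rightarrow> 'a set" where
  "ideal_radical R I = {r \<in> carrier R. \<exists>n::nat. n \<ge> 1 \<and> r [^]\<^bsub>R\<^esub> n \<in> I}"

text \<open>The residual \<open>(N : M)\<close>.\<close>
definition colon ::
  "('a, 'c) ring_scheme \<Rightarrow> ('a, 'b, 'd) module_scheme \<Rightarrow> 'b set \<Rightarrow> 'a set" where
  "colon R M N = {r \<in> carrier R. \<forall>m \<in> carrier M. r \<odot>\<^bsub>M\<^esub> m \<in> N}"

text \<open>The submodule \<open>I M\<close> generated by all products \<open>a m\<close> with \<open>a \<in> I\<close> and \<open>m \<in> M\<close>.\<close>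
definition ideal_smult ::
  "('a, 'c) ring_scheme \<Rightarrow> ('a, 'b, 'd) module_scheme \<Rightarrow> 'a set \<Rightarrow> 'b set" where
  "ideal_smult R M I =
    \<Inter>{H. submodule H R M \<and> (\<forall>a \<in> I. \<forall>m \<in> carrier M. a \<odot>\<^bsub>M\<^esub> m \<in> H)}"

definition weakly_primary_submodule ::
  "('a, 'c) ring_scheme \<Rightarrow> ('a, 'b, 'd) module_scheme \<Rightarrow> 'b set \<Rightarrow> bool" where
  "weakly_primary_submodule R M N \<longleftrightarrow>
    submodule N R M \<and> N \<noteq> carrier M \<and>
    (\<forall>r \<in> carrier R. \<forall>m \<in> carrier M.
      r \<odot>\<^bsub>M\<^esub> m \<noteq> \<zero>\<^bsub>M\<^esub> \<and> r \<odot>\<^bsub>M\<^esub> m \<in> N \<longrightarrow> r \<in> ideal_radical R (colon R M N) \<or> m \<in> N)"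

definition weakly_J_submodule ::
  "('a, 'c) ring_scheme \<Rightarrow> ('a, 'b, 'd) module_scheme \<Rightarrow> 'b set \<Rightarrow> bool" where
  "weakly_J_submodule R M N \<longleftrightarrow>
    submodule N R M \<and> N \<noteq> carrier M \<and>
    (\<forall>r \<in> carrier R. \<forall>m \<in> carrier M.
      r \<odot>\<^bsub>M\<^esub> m \<noteq> \<zero>\<^bsub>M\<^esub> \<and> r \<odot>\<^bsub>M\<^esub> m \<in> N \<and>
      r \<notin> colon R M (ideal_smult R M (jacobson_radical R)) \<longrightarrow> m \<in> N)"

end

theory Submission
  imports Defs
begin

text \<open>
  Let \<open>r m\<close> be a nonzero element of \<open>N\<close> with \<open>r M\<close> not contained in \<open>J(R) M\<close>. Then \<open>r\<close> is not
  in \<open>J(R)\<close>, because elements of \<open>J(R)\<close> multiply \<open>M\<close> into \<open>J(R) M\<close>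
  (\<open>ideal_subset_colon_ideal_smult\<close>). As an intersection of maximal, hence prime, ideals,
  \<open>J(R)\<close> is a radical ideal, so it contains the radical of everything that it contains, in
  particular that of \<open>(N : M)\<close> (\<open>ideal_radical_subset_jacobson_radical\<close>). Hence \<open>r\<close> is not
  in the radical of \<open>(N : M)\<close>, and the weakly primary condition leaves only \<open>m \<in> N\<close>.
\<close>

lemma (in primeideal) mem_if_pow_mem:
  assumes "r \<in> carrier R" and "r [^] (n::nat) \<in> I"
  shows "r \<in> I"
  using assms(2)
proof (induction n)
  case 0
  then have "I = carrier R"
    by (simp add: one_imp_carrier)
  with I_notcarr show ?case
    by simp
next
  case (Suc n)
  then show ?case
    using I_prime[of "r [^] n" r] assms(1) by auto
qed

lemma (in cring) ideal_radical_subset_jacobson_radical: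
  assumes "A \<subseteq> jacobson_radical R"
  shows "ideal_radical R A \<subseteq> jacobson_radical R"
proof
  fix r
  assume "r \<in> ideal_radical R A"
  then obtain n :: nat where r: "r \<in> carrier R" and pow: "r [^] n \<in> jacobson_radical R"
    using assms unfolding ideal_radical_def by blast
  have "r \<in> I" if "maximalideal I R" for I
    using primeideal.mem_if_pow_mem[OF maximalideal_prime[OF that] r] pow that
    unfolding jacobson_radical_def by blast
  with r show "r \<in> jacobson_radical R"
    unfolding jacobson_radical_def by blast
qed

lemma ideal_subset_colon_ideal_smult:
  assumes "I \<subseteq> carrier R"
  shows "I \<subseteq> colon R M (ideal_smult R M I)"
  using assms unfolding colon_def ideal_smult_def by blast

theorem proposition13:
  fixes R :: "('a, 'c) ring_scheme" and M :: "('a, 'b, 'd) module_scheme" and N :: "'b set"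
  assumes "module R M"
    and "weakly_primary_submodule R M N"
    and "colon R M N \<subseteq> jacobson_radical R"
  shows "weakly_J_submodule R M N"
proof -
  interpret module R M
    by fact
  have "jacobson_radical R \<subseteq> carrier R"
    unfolding jacobson_radical_def by blast
  then have "ideal_radical R (colon R M N)
      \<subseteq> colon R M (ideal_smult R M (jacobson_radical R))"
    using R.ideal_radical_subset_jacobson_radical[OF assms(3)] ideal_subset_colon_ideal_smult
    by blast
  then show ?thesis
    using assms(2) unfolding weakly_primary_submodule_def weakly_J_submodule_def by blast
qed

end
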